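(* Let $R$ be a commutative ring and $\mathfrak a\subseteq R$ an ideal. a) The following implications hold: if $\mathfrak a$ is weakly fair, then $\mathfrak a$ is weakly quasifair; if $\mathfrak a$ is weakly quasifair, then $\mathfrak a$ is centred; if $\mathfrak a$ is centred, then $\mathfrak a$ is weakly large quasifair; if $\mathfrak a$ is weakly large fair, then $\mathfrak a$ is weakly large quasifair. b) Suppose that $\mathfrak a$ is half-centred. Then: $\mathfrak a$ is weakly fair if and only if $\mathfrak a$ is weakly large fair; the properties "$\mathfrak a$ is weakly quasifair", "$\mathfrak a$ is centred" and "$\mathfrak a$ is weakly large quasifair" are equivalent; if $\mathfrak a$ is weakly fair, then $\mathfrak a$ is weakly quasifair; and if $\mathfrak a$ is weakly large fair, then $\mathfrak a$ is weakly large quasifair.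
   Context: Rings are commutative with unit (possibly zero). For a ring $R$, an ideal $\mathfrak a\subseteq R$ and an $R$-module $M$: $\operatorname{Var}(\mathfrak a)=\{\mathfrak p\in\operatorname{Spec}(R)\mid\mathfrak a\subseteq\mathfrak p\}$; $\Gamma_{\mathfrak a}(M)=\{x\in M\mid\exists n\in\mathbb N:\mathfrak a^n\subseteq(0:_Rx)\}$; $\overline\Gamma_{\mathfrak a}(M)=\{x\in M\mid\mathfrak a\subseteq\sqrt{(0:_Rx)}\}$; $\operatorname{Ass}^{\mathrm f}_R(M)=\{\mathfrak p\in\operatorname{Spec}(R)\mid\exists x\in M:\mathfrak p\in\min(0:_Rx)\}$ (weak assassin), where $\min(\mathfrak b)$ is the set of minimal elements of $\operatorname{Var}(\mathfrak b)$. The ideal $\mathfrak a$ is called: - weakly fair if $\operatorname{Ass}^{\mathrm f}_R(M/\Gamma_{\mathfrak a}(M))=\operatorname{Ass}^{\mathrm f}_R(M)\setminus\operatorname{Var}(\mathfrak a)$ for every $R$-module $M$; - weakly large fair if $\operatorname{Ass}^{\mathrm f}_R(M/\overline\Gamma_{\mathfrak a}(M))=\operatorname{Ass}^{\mathrm f}_R(M)\setminus\operatorname{Var}(\mathfrak a)$ for every $R$-module $M$; - weakly quasifair if $\operatorname{Ass}^{\mathrm f}_R(\Gamma_{\mathfrak a}(M))=\operatorname{Ass}^{\mathrm f}_R(M)\cap\operatorname{Var}(\mathfrak a)$ for every $R$-module $M$; - weakly large quasifair if $\operatorname{Ass}^{\mathrm f}_R(\overline\Gamma_{\mathfrak a}(M))=\operatorname{Ass}^{\mathrm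 f}_R(M)\cap\operatorname{Var}(\mathfrak a)$ for every $R$-module $M$; - centred if, for every $R$-module $M$, $\Gamma_{\mathfrak a}(M)=0\Leftrightarrow\operatorname{Ass}^{\mathrm f}_R(M)\cap\operatorname{Var}(\mathfrak a)=\emptyset$; - half-centred if, for every $R$-module $M$, $\Gamma_{\mathfrak a}(M)=M\Leftrightarrow\operatorname{Ass}^{\mathrm f}_R(M)\subseteq\operatorname{Var}(\mathfrak a)$. *)

theory Defs
  imports "HOL-Algebra.Module" "HOL-Algebra.QuotRing" "HOL-Algebra.Ideal_Product"
begin

section \<open>Prime spectrum, varieties, radicals, annihilators\<close>

definition Spec :: "('a, 'r) ring_scheme \<Rightarrow> 'a set set" where
  "Spec R = {\<pp>. primeideal \<pp> R}"

definition Var :: "('a, 'r) ring_scheme \<Rightarrow> 'a set \<Rightarrow> 'a set set" where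
  "Var R \<aa> = {\<pp> \<in> Spec R. \<aa> \<subseteq> \<pp>}"

definition min_primes :: "('a, 'r) ring_scheme \<Rightarrow> 'a set \<Rightarrow> 'a set set" where
  "min_primes R \<bb> = {\<pp> \<in> Var R \<bb>. \<forall>\<qq> \<in> Var R \<bb>. \<qq> \<subseteq> \<pp> \<longrightarrow> \<qq> = \<pp>}"

definition radical :: "('a, 'r) ring_scheme \<Rightarrow> 'a set \<Rightarrow> 'a set" where
  "radical R \<bb> = {r \<in> carrier R. \<exists>n::nat. r [^]\<^bsub>R\<^esub> n \<in> \<bb>}"

definition annihilator ::
  "('a, 'r) ring_scheme \<Rightarrow> ('a, 'b, 'x) module_scheme \<Rightarrow> 'b \<Rightarrow> 'a set" where
  "annihilator R M x = {r \<in> carrier R. r \<odot>\<^bsub>M\<^esub> x = \<zero>\<^bsub>M\<^esub>}"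


section \<open>Submodules and quotients as modules\<close>

definition sub_module :: "('a, 'b, 'x) module_scheme \<Rightarrow> 'b set \<Rightarrow> ('a, 'b, 'x) module_scheme" where
  "sub_module M N = M\<lparr>carrier := N\<rparr>"

text \<open>
  The record type of modules extends that of rings, but the locale \<^locale>\<open>module\<close> does not
  constrain the fields for multiplication and unit; they are irrelevant in the quotient.
\<close>

definition quot_module :: "('a, 'b, 'x) module_scheme \<Rightarrow> 'b set \<Rightarrow> ('a, 'b set) module" where
  "quot_module M N =
     \<lparr>carrier = a_rcosets\<^bsub>M\<^esub> N, mult = undefined, one = undefined,
      zero = N, add = set_add M,
      smult = (\<lambda>r X. \<Union>x\<in>X. N +>\<^bsub>M\<^esub> (r \<odot>\<^bsub>M\<^esub> x))\<rparr>"

context module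
begin

lemma submodule_abelian_subgroup:
  assumes "submodule N R M"
  shows "abelian_subgroup N M"
  by (rule abelian_subgroupI3 [OF additive_subgroup.intro [OF submodule.axioms(1) [OF assms]]
      M.abelian_group_axioms])

lemma quot_smult_coset:
  assumes N: "submodule N R M" and r: "r \<in> carrier R" and x: "x \<in> carrier M"
  shows "r \<odot>\<^bsub>quot_module M N\<^esub> (N +>\<^bsub>M\<^esub> x) = N +>\<^bsub>M\<^esub> (r \<odot>\<^bsub>M\<^esub> x)"
proof -
  interpret N: abelian_subgroup N M
    by (rule submodule_abelian_subgroup [OF N])
  have *: "N +>\<^bsub>M\<^esub> (r \<odot>\<^bsub>M\<^esub> y) = N +>\<^bsub>M\<^esub> (r \<odot>\<^bsub>M\<^esub> x)" if y: "y \<in> N +>\<^bsub>M\<^esub> x" for y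
  proof -
    obtain h where h: "h \<in> N" "y = h \<oplus>\<^bsub>M\<^esub> x"
      using y by (auto simp: a_r_coset_def')
    have "r \<odot>\<^bsub>M\<^esub> h \<in> N"
      using N r h(1) by (rule submodule.smult_closed)
    moreover have "r \<odot>\<^bsub>M\<^esub> y = r \<odot>\<^bsub>M\<^esub> h \<oplus>\<^bsub>M\<^esub> r \<odot>\<^bsub>M\<^esub> x"
      using h r x N.a_Hcarr by (simp add: smult_r_distr)
    ultimately have "r \<odot>\<^bsub>M\<^esub> y \<in> N +>\<^bsub>M\<^esub> (r \<odot>\<^bsub>M\<^esub> x)"
      by (auto simp: a_r_coset_def')
    then show ?thesis
      by (rule M.a_repr_independence [OF _ smult_closed [OF r x] N.a_subgroup, symmetric])
  qed
  have "x \<in> N +>\<^bsub>M\<^esub> x"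
    using x by (rule N.a_rcos_self)
  then have "(\<Union>y \<in> N +>\<^bsub>M\<^esub> x. N +>\<^bsub>M\<^esub> (r \<odot>\<^bsub>M\<^esub> y)) = N +>\<^bsub>M\<^esub> (r \<odot>\<^bsub>M\<^esub> x)"
    using * by blast
  then show ?thesis
    by (simp add: quot_module_def)
qed

lemma quot_module_is_module:
  assumes N: "submodule N R M"
  shows "module R (quot_module M N)"
proof -
  interpret N: abelian_subgroup N M
    by (rule submodule_abelian_subgroup [OF N])
  have carr: "carrier (quot_module M N) = (\<lambda>x. N +>\<^bsub>M\<^esub> x) ` carrier M"
    by (auto simp: quot_module_def A_RCOSETS_def' a_r_coset_def')
  have add: "(N +>\<^bsub>M\<^esub> x) \<oplus>\<^bsub>quot_module M N\<^esub> (N +>\<^bsub>M\<^esub> y) = N +>\<^bsub>M\<^esub> (x \<oplus>\<^bsub>M\<^esub> y)"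
    if "x \<in> carrier M" "y \<in> carrier M" for x y
    using that by (simp add: quot_module_def N.a_rcos_sum)
  have grp: "abelian_group (quot_module M N)"
  proof (rule abelian_groupI)
    have zero: "\<zero>\<^bsub>quot_module M N\<^esub> = N +>\<^bsub>M\<^esub> \<zero>\<^bsub>M\<^esub>"
      using M.a_coset_add_zero [OF N.a_subset] by (simp add: quot_module_def)
    show "\<zero>\<^bsub>quot_module M N\<^esub> \<in> carrier (quot_module M N)"
      by (auto simp: carr zero)
    show "\<zero>\<^bsub>quot_module M N\<^esub> \<oplus>\<^bsub>quot_module M N\<^esub> X = X"
      if "X \<in> carrier (quot_module M N)" for X
      using that by (auto simp: carr zero add)
    show "\<exists>Y \<in> carrier (quot_module M N). Y \<oplus>\<^bsub>quot_module M N\<^esub> X = \<zero>\<^bsub>quot_module M N\<^esub>"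
      if X: "X \<in> carrier (quot_module M N)" for X
    proof -
      obtain x where x: "x \<in> carrier M" "X = N +>\<^bsub>M\<^esub> x"
        using X by (auto simp: carr)
      then have "(N +>\<^bsub>M\<^esub> (\<ominus>\<^bsub>M\<^esub> x)) \<oplus>\<^bsub>quot_module M N\<^esub> X = \<zero>\<^bsub>quot_module M N\<^esub>"
        by (simp add: add zero M.l_neg)
      with x show ?thesis
        by (auto simp: carr)
    qed
    show "X \<oplus>\<^bsub>quot_module M N\<^esub> Y \<in> carrier (quot_module M N)"
      if "X \<in> carrier (quot_module M N)" "Y \<in> carrier (quot_module M N)" for X Y
      using that by (auto simp: carr add)
    show "X \<oplus>\<^bsub>quot_module M N\<^esub> Y = Y \<oplus>\<^bsub>quot_module M N\<^esub> X"
      if "X \<in> carrier (quot_module M N)" "Y \<in> carrier (quot_module M N)" for X Y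
      using that by (auto simp: carr add M.a_comm)
    show "X \<oplus>\<^bsub>quot_module M N\<^esub> Y \<oplus>\<^bsub>quot_module M N\<^esub> Z
          = X \<oplus>\<^bsub>quot_module M N\<^esub> (Y \<oplus>\<^bsub>quot_module M N\<^esub> Z)"
      if "X \<in> carrier (quot_module M N)" "Y \<in> carrier (quot_module M N)"
        "Z \<in> carrier (quot_module M N)" for X Y Z
      using that by (auto simp: carr add M.a_assoc)
  qed
  note smult = quot_smult_coset [OF N]
  show ?thesis
  proof (rule moduleI [OF R.cring_axioms grp], unfold carr)
    show "r \<odot>\<^bsub>quot_module M N\<^esub> X \<in> (+>\<^bsub>M\<^esub>) N ` carrier M"
      if "r \<in> carrier R" "X \<in> (+>\<^bsub>M\<^esub>) N ` carrier M" for r X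
      using that by (auto simp: smult)
  next
    fix r s X assume rs: "r \<in> carrier R" "s \<in> carrier R" and "X \<in> (+>\<^bsub>M\<^esub>) N ` carrier M"
    then obtain x where "x \<in> carrier M" "X = N +>\<^bsub>M\<^esub> x"
      by blast
    with rs show "(r \<oplus> s) \<odot>\<^bsub>quot_module M N\<^esub> X
        = r \<odot>\<^bsub>quot_module M N\<^esub> X \<oplus>\<^bsub>quot_module M N\<^esub> s \<odot>\<^bsub>quot_module M N\<^esub> X"
      and "(r \<otimes> s) \<odot>\<^bsub>quot_module M N\<^esub> X
        = r \<odot>\<^bsub>quot_module M N\<^esub> (s \<odot>\<^bsub>quot_module M N\<^esub> X)"
      by (simp_all add: smult add smult_l_distr smult_assoc1)
  next
    fix r X Y assume r: "r \<in> carrier R"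
      and "X \<in> (+>\<^bsub>M\<^esub>) N ` carrier M" "Y \<in> (+>\<^bsub>M\<^esub>) N ` carrier M"
    then obtain x y where "x \<in> carrier M" "X = N +>\<^bsub>M\<^esub> x" "y \<in> carrier M" "Y = N +>\<^bsub>M\<^esub> y"
      by blast
    with r show "r \<odot>\<^bsub>quot_module M N\<^esub> (X \<oplus>\<^bsub>quot_module M N\<^esub> Y)
        = r \<odot>\<^bsub>quot_module M N\<^esub> X \<oplus>\<^bsub>quot_module M N\<^esub> r \<odot>\<^bsub>quot_module M N\<^esub> Y"
      by (simp add: smult add smult_r_distr)
  next
    show "\<one> \<odot>\<^bsub>quot_module M N\<^esub> X = X" if "X \<in> (+>\<^bsub>M\<^esub>) N ` carrier M" for X
      using that by (auto simp: smult)
  qed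
qed

end


section \<open>Torsion functors and the weak assassin\<close>

text \<open>
  Powers of ideals are taken in the monoid of ideals, whose unit is the whole ring;
  hence the zeroth power of an ideal is \<^term>\<open>carrier R\<close>.
\<close>

definition small_torsion ::
  "('a, 'r) ring_scheme \<Rightarrow> 'a set \<Rightarrow> ('a, 'b, 'x) module_scheme \<Rightarrow> 'b set" where
  "small_torsion R \<aa> M =
     {x \<in> carrier M. \<exists>n::nat. \<aa> [^]\<^bsub>ideals_set R\<^esub> n \<subseteq> annihilator R M x}"

definition large_torsion ::
  "('a, 'r) ring_scheme \<Rightarrow> 'a set \<Rightarrow> ('a, 'b, 'x) module_scheme \<Rightarrow> 'b set" where
  "large_torsion R \<aa> M = {x \<in> carrier M. \<aa> \<subseteq> radical R (annihilator R M x)}"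

definition weak_Ass :: "('a, 'r) ring_scheme \<Rightarrow> ('a, 'b, 'x) module_scheme \<Rightarrow> 'a set set" where
  "weak_Ass R M = {\<pp> \<in> Spec R. \<exists>x \<in> carrier M. \<pp> \<in> min_primes R (annihilator R M x)}"


section \<open>Fairness properties of ideals\<close>

text \<open>
  HOL cannot quantify over all types inside a formula, so ``for every \<open>R\<close>-module'' is relative
  to a type \<open>'m\<close> playing the role of a universe: the modules considered are those whose carrier
  is a (possibly proper) subset of \<open>'m\<close>. The type is passed explicitly, so that statements about
  these properties can be made for an arbitrary \<open>'m\<close>.
\<close>

definition weakly_fair :: "'m itself \<Rightarrow> ('a, 'r) ring_scheme \<Rightarrow> 'a set \<Rightarrow> bool" where
  "weakly_fair _ R \<aa> \<longleftrightarrow> (\<forall>M :: ('a, 'm) module. module R M \<longrightarrow>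
     weak_Ass R (quot_module M (small_torsion R \<aa> M)) = weak_Ass R M - Var R \<aa>)"

definition weakly_large_fair :: "'m itself \<Rightarrow> ('a, 'r) ring_scheme \<Rightarrow> 'a set \<Rightarrow> bool" where
  "weakly_large_fair _ R \<aa> \<longleftrightarrow> (\<forall>M :: ('a, 'm) module. module R M \<longrightarrow>
     weak_Ass R (quot_module M (large_torsion R \<aa> M)) = weak_Ass R M - Var R \<aa>)"

definition weakly_quasifair :: "'m itself \<Rightarrow> ('a, 'r) ring_scheme \<Rightarrow> 'a set \<Rightarrow> bool" where
  "weakly_quasifair _ R \<aa> \<longleftrightarrow> (\<forall>M :: ('a, 'm) module. module R M \<longrightarrow>
     weak_Ass R (sub_module M (small_torsion R \<aa> M)) = weak_Ass R M \<inter> Var R \<aa>)"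

definition weakly_large_quasifair :: "'m itself \<Rightarrow> ('a, 'r) ring_scheme \<Rightarrow> 'a set \<Rightarrow> bool" where
  "weakly_large_quasifair _ R \<aa> \<longleftrightarrow> (\<forall>M :: ('a, 'm) module. module R M \<longrightarrow>
     weak_Ass R (sub_module M (large_torsion R \<aa> M)) = weak_Ass R M \<inter> Var R \<aa>)"

definition centred :: "'m itself \<Rightarrow> ('a, 'r) ring_scheme \<Rightarrow> 'a set \<Rightarrow> bool" where
  "centred _ R \<aa> \<longleftrightarrow> (\<forall>M :: ('a, 'm) module. module R M \<longrightarrow>
     (small_torsion R \<aa> M = {\<zero>\<^bsub>M\<^esub>} \<longleftrightarrow> weak_Ass R M \<inter> Var R \<aa> = {}))"

definition half_centred :: "'m itself \<Rightarrow> ('a, 'r) ring_scheme \<Rightarrow> 'a set \<Rightarrow> bool" where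
  "half_centred _ R \<aa> \<longleftrightarrow> (\<forall>M :: ('a, 'm) module. module R M \<longrightarrow>
     (small_torsion R \<aa> M = carrier M \<longleftrightarrow> weak_Ass R M \<subseteq> Var R \<aa>))"

end

theory Submission
  imports Defs
begin

text \<open>
  Write \<open>\<Gamma>\<close> for the small and \<open>\<Gamma>'\<close> for the large torsion submodule of \<open>M\<close>. Three facts carry
  everything.

  (1) For a submodule \<open>N\<close> of \<open>M\<close>, every weakly associated prime of \<open>M\<close> is one of \<open>N\<close> or one of
  \<open>M/N\<close> (\<open>weak_Ass_sub_or_quot\<close>), and a nonzero module has a weakly associated prime
  (\<open>weak_Ass_empty_iff\<close>, which rests on the existence of minimal primes over proper ideals).

  (2) \<open>\<Gamma> \<subseteq> \<Gamma>'\<close>, and all weakly associated primes of \<open>\<Gamma>'\<close> contain \<open>\<aa>\<close>, because the annihilator of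
  a torsion element has a radical containing \<open>\<aa>\<close>.

  (3) \<open>\<Gamma>'\<close> is a radical functor: \<open>M/\<Gamma>'\<close> has no large torsion, and hence no small torsion either.
  The small torsion functor lacks this property in general, which is why the argument passes from
  centredness to large quasifairness.

  By (1) and (2), if no weakly associated prime of \<open>M/N\<close> contains \<open>\<aa>\<close>, where \<open>N\<close> is \<open>\<Gamma>\<close> or \<open>\<Gamma>'\<close>,
  then the weakly associated primes of \<open>N\<close> are exactly those of \<open>M\<close> that contain \<open>\<aa>\<close>
  (\<open>weak_Ass_sub_eq_inter_Var\<close>). Fairness provides the hypothesis at once, and so does
  centredness, applied to \<open>M/\<Gamma>'\<close>. Quasifairness implies centredness because \<open>\<Gamma> = 0\<close> exactly if
  \<open>\<Gamma>\<close> has no weakly associated prime. Finally, a half-centred ideal satisfies \<open>\<Gamma> = \<Gamma>'\<close> for every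
  module: by (2) half-centredness applies to the module \<open>\<Gamma>'\<close> and says that it equals its small
  torsion submodule. So the two variants of each property coincide.

  The one use of a hypothesis at a quotient module needs some care, since the elements of \<open>M/N\<close>
  are sets of elements of \<open>M\<close>, while the properties speak of modules over one fixed type. The
  quotient is therefore replaced by an isomorphic module on coset representatives.
\<close>

section \<open>Minimal primes\<close>

context cring
begin

lemma Union_chain_of_ideals:
  assumes ne: "C \<noteq> {}"
    and chain: "\<And>J K. J \<in> C \<Longrightarrow> K \<in> C \<Longrightarrow> J \<subseteq> K \<or> K \<subseteq> J"
    and ideals: "\<And>J. J \<in> C \<Longrightarrow> ideal J R"
  shows "ideal (\<Union>C) R"
proof (rule idealI [OF ring_axioms])
  note sg = additive_subgroup.a_subgroup [OF ideal.axioms(1) [OF ideals]]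
  show "subgroup (\<Union>C) (add_monoid R)"
  proof (rule add.subgroupI)
    show "\<Union>C \<subseteq> carrier R"
      using ideals by (auto dest: ideal.Icarr)
    show "\<Union>C \<noteq> {}"
      using ne subgroup.one_closed [OF sg] by fastforce
    show "\<ominus> x \<in> \<Union>C" if "x \<in> \<Union>C" for x
      using that subgroup.m_inv_closed [OF sg] by (auto simp flip: a_inv_def)
    show "x \<oplus> y \<in> \<Union>C" if xy: "x \<in> \<Union>C" "y \<in> \<Union>C" for x y
    proof -
      obtain J where "J \<in> C" "x \<in> J" "y \<in> J"
        using xy chain by blast
      then show ?thesis
        using subgroup.m_closed [OF sg] by auto
    qed
  qed
qed (use ideals in \<open>auto intro: ideal.I_l_closed ideal.I_r_closed\<close>)

lemma exists_prime_over_proper_ideal: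
  assumes I: "ideal I R" and proper: "I \<noteq> carrier R"
  shows "\<exists>\<pp> \<in> Spec R. I \<subseteq> \<pp>"
proof -
  let ?A = "{J. ideal J R \<and> I \<subseteq> J \<and> \<one> \<notin> J}"
  have "I \<in> ?A"
    using I proper ideal.one_imp_carrier by auto
  moreover have "\<Union>C \<in> ?A" if "C \<noteq> {}" "subset.chain ?A C" for C
  proof -
    have CA: "C \<subseteq> ?A" and tot: "\<And>J K. J \<in> C \<Longrightarrow> K \<in> C \<Longrightarrow> J \<subseteq> K \<or> K \<subseteq> J"
      using that(2) by (auto simp: pred_on.chain_def)
    have "ideal (\<Union>C) R"
      by (rule Union_chain_of_ideals) (use that(1) tot CA in blast)+
    with CA show ?thesis
      using that(1) by blast
  qed
  ultimately obtain J where J: "J \<in> ?A" and max: "\<And>K. K \<in> ?A \<Longrightarrow> J \<subseteq> K \<Longrightarrow> K = J"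
    using subset_Zorn_nonempty [of ?A] by (metis (no_types, lifting) empty_iff)
  have "maximalideal J R"
  proof (rule maximalidealI)
    show "ideal J R" "carrier R \<noteq> J"
      using J by auto
    show "K = J \<or> K = carrier R" if "ideal K R" "J \<subseteq> K" "K \<subseteq> carrier R" for K
      using that J max [of K] ideal.one_imp_carrier by blast
  qed
  then have "J \<in> Spec R"
    by (simp add: Spec_def maximalideal_prime)
  with J show ?thesis
    by blast
qed

lemma Inter_chain_of_primes:
  assumes ne: "C \<noteq> {}" and primes: "C \<subseteq> Spec R"
    and chain: "\<And>\<pp> \<qq>. \<pp> \<in> C \<Longrightarrow> \<qq> \<in> C \<Longrightarrow> \<pp> \<subseteq> \<qq> \<or> \<qq> \<subseteq> \<pp>"
  shows "\<Inter>C \<in> Spec R"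
proof -
  have prime: "primeideal \<pp> R" if "\<pp> \<in> C" for \<pp>
    using that primes by (auto simp: Spec_def)
  have "primeideal (\<Inter>C) R"
  proof (rule primeidealI)
    show "ideal (\<Inter>C) R"
      using ne prime by (intro i_Intersect) (auto intro: primeideal.axioms)
    show "cring R"
      by (rule is_cring)
    obtain \<pp> where "\<pp> \<in> C"
      using ne by blast
    then have "\<one> \<notin> \<pp>"
      using prime [of \<pp>] ideal.one_imp_carrier primeideal.I_notcarr primeideal.axioms(1) by metis
    with \<open>\<pp> \<in> C\<close> show "carrier R \<noteq> \<Inter>C"
      by (metis InterD one_closed)
    show "a \<in> \<Inter>C \<or> b \<in> \<Inter>C" if ab: "a \<in> carrier R" "b \<in> carrier R" "a \<otimes> b \<in> \<Inter>C" for a b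
    proof (rule ccontr)
      assume "\<not> ?thesis"
      then obtain \<pp> \<qq> where pq: "\<pp> \<in> C" "\<qq> \<in> C" "a \<notin> \<pp>" "b \<notin> \<qq>"
        by blast
      \<comment> \<open>The smaller of the two primes contains neither factor.\<close>
      with chain [of \<pp> \<qq>] obtain \<rr> where "\<rr> \<in> C" "a \<notin> \<rr>" "b \<notin> \<rr>"
        by blast
      with ab prime [of \<rr>] show False
        using primeideal.I_prime by fastforce
    qed
  qed
  then show ?thesis
    by (simp add: Spec_def)
qed

lemma min_primes_nonempty:
  assumes I: "ideal I R" and proper: "I \<noteq> carrier R"
  shows "min_primes R I \<noteq> {}"
proof -
  \<comment> \<open>Zorn's lemma yields maximal sets, so it is applied to the complements of primes.\<close>
  let ?A = "(\<lambda>\<pp>. carrier R - \<pp>) ` Var R I"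
  have sub: "\<pp> \<subseteq> carrier R" if "\<pp> \<in> Var R I" for \<pp>
    using that by (auto simp: Var_def Spec_def primeideal_def dest: ideal.Icarr)
  have "Var R I \<noteq> {}"
    using exists_prime_over_proper_ideal [OF assms] by (auto simp: Var_def)
  then have "?A \<noteq> {}"
    by blast
  moreover have "\<Union>C \<in> ?A" if C: "C \<noteq> {}" "subset.chain ?A C" for C
  proof -
    let ?P = "{\<pp> \<in> Var R I. carrier R - \<pp> \<in> C}"
    have CA: "C \<subseteq> ?A" and tot: "\<And>X Y. X \<in> C \<Longrightarrow> Y \<in> C \<Longrightarrow> X \<subseteq> Y \<or> Y \<subseteq> X"
      using C(2) unfolding pred_on.chain_def by blast+
    have ne: "?P \<noteq> {}"
      using C(1) CA by blast
    have "\<Inter>?P \<in> Spec R"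
    proof (rule Inter_chain_of_primes [OF ne])
      show "?P \<subseteq> Spec R"
        by (auto simp: Var_def)
      show "\<pp> \<subseteq> \<qq> \<or> \<qq> \<subseteq> \<pp>" if "\<pp> \<in> ?P" "\<qq> \<in> ?P" for \<pp> \<qq>
      proof -
        have "\<pp> \<subseteq> carrier R" "\<qq> \<subseteq> carrier R"
          using that sub by auto
        then show ?thesis
          using that tot [of "carrier R - \<pp>" "carrier R - \<qq>"] by blast
      qed
    qed
    moreover have "I \<subseteq> \<Inter>?P"
      by (auto simp: Var_def)
    ultimately have "\<Inter>?P \<in> Var R I"
      by (simp add: Var_def)
    moreover have "\<Union>C = carrier R - \<Inter>?P"
      using CA by auto
    ultimately show ?thesis
      by blast
  qed
  ultimately obtain X where X: "X \<in> ?A" and max: "\<And>Y. Y \<in> ?A \<Longrightarrow> X \<subseteq> Y \<Longrightarrow> Y = X"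
    using subset_Zorn_nonempty [of ?A] by (metis (no_types, lifting))
  then obtain \<pp> where \<pp>: "\<pp> \<in> Var R I" "X = carrier R - \<pp>"
    by blast
  have "\<qq> = \<pp>" if "\<qq> \<in> Var R I" "\<qq> \<subseteq> \<pp>" for \<qq>
  proof -
    have "carrier R - \<qq> = carrier R - \<pp>"
      using that \<pp> max [of "carrier R - \<qq>"] by blast
    then show ?thesis
      using sub [OF \<pp>(1)] sub [OF that(1)] by blast
  qed
  with \<pp> show ?thesis
    by (auto simp: min_primes_def)
qed

text \<open>
  Minimality over \<open>I\<close> persists over any larger ideal still inside the prime; this is how weakly
  associated primes pass between a module, its submodules and its quotients.
\<close>

lemma min_primes_enlarge:
  assumes "\<pp> \<in> min_primes R I" "I \<subseteq> J" "J \<subseteq> \<pp>"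
  shows "\<pp> \<in> min_primes R J"
  using assms unfolding min_primes_def Var_def by blast


section \<open>Powers of ideals\<close>

lemma ideal_pow_is_ideal:
  assumes "ideal \<aa> R"
  shows "ideal (\<aa> [^]\<^bsub>ideals_set R\<^esub> (n::nat)) R"
proof -
  interpret I: semiring "ideals_set R"
    by (rule ideals_set_is_semiring)
  have "\<aa> \<in> carrier (ideals_set R)"
    using assms by (simp add: ideals_set_def)
  then have "\<aa> [^]\<^bsub>ideals_set R\<^esub> n \<in> carrier (ideals_set R)"
    by (rule I.nat_pow_closed)
  then show ?thesis
    by (simp add: ideals_set_def)
qed

lemma ideal_pow_Suc: "\<aa> [^]\<^bsub>ideals_set R\<^esub> Suc n = ideal_prod R (\<aa> [^]\<^bsub>ideals_set R\<^esub> n) \<aa>"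
  by (simp add: nat_pow_def) (simp add: ideals_set_def)

lemma ideal_pow_antimono:
  assumes "ideal \<aa> R" and "m \<le> n"
  shows "\<aa> [^]\<^bsub>ideals_set R\<^esub> n \<subseteq> \<aa> [^]\<^bsub>ideals_set R\<^esub> (m::nat)"
  using assms(2)
proof (rule lift_Suc_antimono_le [rotated])
  show "\<aa> [^]\<^bsub>ideals_set R\<^esub> Suc k \<subseteq> \<aa> [^]\<^bsub>ideals_set R\<^esub> k" for k
    using ideal_prod_inter [OF ideal_pow_is_ideal [OF assms(1)] assms(1)]
    unfolding ideal_pow_Suc by blast
qed

lemma pow_mem_ideal_pow:
  assumes "ideal \<aa> R" and a: "a \<in> \<aa>"
  shows "a [^] n \<in> \<aa> [^]\<^bsub>ideals_set R\<^esub> (n::nat)"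
proof (induction n)
  case 0
  then show ?case
    by (simp add: nat_pow_def) (simp add: ideals_set_def)
next
  case (Suc n)
  then show ?case
    unfolding ideal_pow_Suc nat_pow_Suc using a by (rule ideal_prod.prod)
qed

end


section \<open>Annihilators and the weak assassin\<close>

context module
begin

lemma smult_left_commute:
  assumes "r \<in> carrier R" "s \<in> carrier R" "x \<in> carrier M"
  shows "r \<odot>\<^bsub>M\<^esub> (s \<odot>\<^bsub>M\<^esub> x) = s \<odot>\<^bsub>M\<^esub> (r \<odot>\<^bsub>M\<^esub> x)"
  using assms by (simp add: R.m_comm flip: smult_assoc1)

lemma annihilator_is_ideal:
  assumes x: "x \<in> carrier M"
  shows "ideal (annihilator R M x) R"
proof (rule idealI)
  show "subgroup (annihilator R M x) (add_monoid R)"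
    using x by (intro R.add.subgroupI)
      (auto simp: annihilator_def smult_l_distr smult_l_minus simp flip: a_inv_def)
  fix a r assume a: "a \<in> annihilator R M x" and r: "r \<in> carrier R"
  with x show "r \<otimes> a \<in> annihilator R M x"
    by (auto simp: annihilator_def smult_assoc1)
  with a r show "a \<otimes> r \<in> annihilator R M x"
    by (auto simp: annihilator_def R.m_comm)
qed (rule R.ring_axioms)

lemma annihilator_eq_carrier_iff:
  assumes x: "x \<in> carrier M"
  shows "annihilator R M x = carrier R \<longleftrightarrow> x = \<zero>\<^bsub>M\<^esub>"
proof
  assume "annihilator R M x = carrier R"
  then have "\<one> \<in> annihilator R M x"
    by simp
  then show "x = \<zero>\<^bsub>M\<^esub>"
    using x by (simp add: annihilator_def)
qed (auto simp: annihilator_def)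

lemma weak_Ass_empty_iff: "weak_Ass R M = {} \<longleftrightarrow> carrier M = {\<zero>\<^bsub>M\<^esub>}"
proof
  assume empty: "weak_Ass R M = {}"
  have "x = \<zero>\<^bsub>M\<^esub>" if x: "x \<in> carrier M" for x
  proof (rule ccontr)
    assume "x \<noteq> \<zero>\<^bsub>M\<^esub>"
    then have "min_primes R (annihilator R M x) \<noteq> {}"
      using annihilator_eq_carrier_iff [OF x]
      by (intro R.min_primes_nonempty annihilator_is_ideal x) simp
    then obtain \<pp> where "\<pp> \<in> min_primes R (annihilator R M x)"
      by blast
    then have "\<pp> \<in> weak_Ass R M"
      using x by (auto simp: weak_Ass_def min_primes_def Var_def)
    with empty show False
      by blast
  qed
  then show "carrier M = {\<zero>\<^bsub>M\<^esub>}"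
    by auto
next
  assume zero: "carrier M = {\<zero>\<^bsub>M\<^esub>}"
  have "annihilator R M \<zero>\<^bsub>M\<^esub> = carrier R"
    using annihilator_eq_carrier_iff by blast
  moreover have "min_primes R (carrier R) = {}"
    by (auto simp: min_primes_def Var_def Spec_def primeideal_def primeideal_axioms_def
        dest: ideal.Icarr)
  ultimately show "weak_Ass R M = {}"
    using zero by (auto simp: weak_Ass_def)
qed

lemma sub_module_is_module:
  assumes "submodule N R M"
  shows "module R (sub_module M N)"
  unfolding sub_module_def by (rule submodule.submodule_is_module [OF assms module_axioms])

lemma annihilator_sub_module [simp]: "annihilator R (sub_module M N) x = annihilator R M x"
  by (simp add: annihilator_def sub_module_def)

lemma carrier_sub_module [simp]: "carrier (sub_module M N) = N"
  by (simp add: sub_module_def)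

lemma zero_sub_module [simp]: "\<zero>\<^bsub>sub_module M N\<^esub> = \<zero>\<^bsub>M\<^esub>"
  by (simp add: sub_module_def)

lemma weak_Ass_sub_module:
  assumes "submodule N R M"
  shows "weak_Ass R (sub_module M N) \<subseteq> weak_Ass R M"
  using submoduleE(1) [OF assms] by (auto simp: weak_Ass_def)

lemma carrier_quot_module: "carrier (quot_module M N) = (\<lambda>x. N +>\<^bsub>M\<^esub> x) ` carrier M"
  by (auto simp: quot_module_def A_RCOSETS_def' a_r_coset_def')

lemma coset_eq_zero_iff:
  assumes N: "submodule N R M" and x: "x \<in> carrier M"
  shows "N +>\<^bsub>M\<^esub> x = \<zero>\<^bsub>quot_module M N\<^esub> \<longleftrightarrow> x \<in> N"
proof -
  interpret N: abelian_subgroup N M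
    by (rule submodule_abelian_subgroup [OF N])
  show ?thesis
    using N.a_rcos_const N.a_rcos_self [OF x] by (auto simp: quot_module_def)
qed

lemma annihilator_quot_module:
  assumes N: "submodule N R M" and x: "x \<in> carrier M"
  shows "annihilator R (quot_module M N) (N +>\<^bsub>M\<^esub> x) = {r \<in> carrier R. r \<odot>\<^bsub>M\<^esub> x \<in> N}"
  unfolding annihilator_def using x
  by (intro Collect_cong conj_cong refl) (simp add: quot_smult_coset [OF N] coset_eq_zero_iff [OF N])

text \<open>
  Let \<open>\<pp>\<close> be minimal over the annihilator of \<open>x\<close>. Either \<open>\<pp>\<close> contains the annihilator of the
  class of \<open>x\<close>, or some \<open>s \<notin> \<pp>\<close> moves \<open>x\<close> into \<open>N\<close>; in the latter case primality keeps the
  annihilator of \<open>s x\<close> inside \<open>\<pp>\<close>.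
\<close>

lemma weak_Ass_sub_or_quot:
  assumes N: "submodule N R M"
  shows "weak_Ass R M \<subseteq> weak_Ass R (sub_module M N) \<union> weak_Ass R (quot_module M N)"
proof
  fix \<pp> assume "\<pp> \<in> weak_Ass R M"
  then obtain x where spec: "\<pp> \<in> Spec R" and x: "x \<in> carrier M"
    and min: "\<pp> \<in> min_primes R (annihilator R M x)"
    by (auto simp: weak_Ass_def)
  interpret \<pp>: primeideal \<pp> R
    using spec by (simp add: Spec_def)
  let ?b = "annihilator R (quot_module M N) (N +>\<^bsub>M\<^esub> x)"
  have b: "?b = {r \<in> carrier R. r \<odot>\<^bsub>M\<^esub> x \<in> N}"
    by (rule annihilator_quot_module [OF N x])
  have ann_b: "annihilator R M x \<subseteq> ?b"
    unfolding b using subgroup.one_closed [OF submodule.axioms(1) [OF N]]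
    by (auto simp: annihilator_def)
  show "\<pp> \<in> weak_Ass R (sub_module M N) \<union> weak_Ass R (quot_module M N)"
  proof (cases "?b \<subseteq> \<pp>")
    case True
    then have "\<pp> \<in> weak_Ass R (quot_module M N)"
      using R.min_primes_enlarge [OF min ann_b] spec x
      by (auto simp: weak_Ass_def carrier_quot_module)
    then show ?thesis ..
  next
    case False
    then obtain s where s: "s \<in> carrier R" "s \<odot>\<^bsub>M\<^esub> x \<in> N" "s \<notin> \<pp>"
      by (auto simp: b)
    have ann_x: "annihilator R M x \<subseteq> \<pp>"
      using min by (simp add: min_primes_def Var_def)
    have "annihilator R M x \<subseteq> annihilator R M (s \<odot>\<^bsub>M\<^esub> x)"
    proof
      fix r assume "r \<in> annihilator R M x"
      then have r: "r \<in> carrier R" "r \<odot>\<^bsub>M\<^esub> x = \<zero>\<^bsub>M\<^esub>"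
        by (auto simp: annihilator_def)
      then have "r \<odot>\<^bsub>M\<^esub> (s \<odot>\<^bsub>M\<^esub> x) = s \<odot>\<^bsub>M\<^esub> (r \<odot>\<^bsub>M\<^esub> x)"
        using s(1) x by (intro smult_left_commute)
      with r s(1) show "r \<in> annihilator R M (s \<odot>\<^bsub>M\<^esub> x)"
        by (simp add: annihilator_def)
    qed
    moreover have "annihilator R M (s \<odot>\<^bsub>M\<^esub> x) \<subseteq> \<pp>"
    proof
      fix r assume "r \<in> annihilator R M (s \<odot>\<^bsub>M\<^esub> x)"
      then have r: "r \<in> carrier R" "(r \<otimes> s) \<odot>\<^bsub>M\<^esub> x = \<zero>\<^bsub>M\<^esub>"
        using s(1) x by (auto simp: annihilator_def smult_assoc1)
      then have "r \<otimes> s \<in> \<pp>"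
        using s(1) ann_x by (auto simp: annihilator_def)
      then show "r \<in> \<pp>"
        using \<pp>.I_prime r(1) s(1,3) by blast
    qed
    ultimately have "\<pp> \<in> min_primes R (annihilator R M (s \<odot>\<^bsub>M\<^esub> x))"
      by (rule R.min_primes_enlarge [OF min])
    then have "\<pp> \<in> weak_Ass R (sub_module M N)"
      using spec s(2) by (auto simp: weak_Ass_def)
    then show ?thesis ..
  qed
qed

lemma weak_Ass_sub_eq_inter_Var:
  assumes "submodule N R M"
    and "weak_Ass R (sub_module M N) \<subseteq> Var R \<aa>"
    and "weak_Ass R (quot_module M N) \<inter> Var R \<aa> = {}"
  shows "weak_Ass R (sub_module M N) = weak_Ass R M \<inter> Var R \<aa>"
  using weak_Ass_sub_module [OF assms(1)] weak_Ass_sub_or_quot [OF assms(1)] assms(2-3)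
  by blast


end


section \<open>Transporting quotients along coset representatives\<close>

text \<open>
  The weak assassin and the vanishing of the small torsion depend on a module only through the set
  of annihilators of its elements, so no more than this set needs to be preserved.
\<close>

lemma weak_Ass_eq_Union_min_primes:
  "weak_Ass R M = Spec R \<inter> (\<Union>\<bb> \<in> annihilator R M ` carrier M. min_primes R \<bb>)"
  by (auto simp: weak_Ass_def)

lemma (in module) small_torsion_eq_zero_iff:
  assumes "ideal \<aa> R"
  shows "small_torsion R \<aa> M = {\<zero>\<^bsub>M\<^esub>} \<longleftrightarrow>
    (\<forall>\<bb> \<in> annihilator R M ` carrier M.
       (\<exists>n::nat. \<aa> [^]\<^bsub>ideals_set R\<^esub> n \<subseteq> \<bb>) \<longrightarrow> \<bb> = carrier R)"
proof -
  have "\<aa> [^]\<^bsub>ideals_set R\<^esub> n \<subseteq> annihilator R M \<zero>\<^bsub>M\<^esub>" for n :: nat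
    using ideal.Icarr [OF R.ideal_pow_is_ideal [OF assms]]
      annihilator_eq_carrier_iff [OF M.zero_closed] by auto
  then show ?thesis
    by (auto simp: small_torsion_def annihilator_eq_carrier_iff)
qed

definition transport_module :: "('b \<Rightarrow> 'c) \<Rightarrow> ('a, 'b, 'x) module_scheme \<Rightarrow> ('a, 'c) module" where
  "transport_module f M =
     (let g = inv_into (carrier M) f in
      \<lparr>carrier = f ` carrier M, mult = undefined, one = undefined,
       zero = f \<zero>\<^bsub>M\<^esub>, add = (\<lambda>u v. f (g u \<oplus>\<^bsub>M\<^esub> g v)),
       smult = (\<lambda>r u. f (r \<odot>\<^bsub>M\<^esub> g u))\<rparr>)"

context module
begin

context
  fixes f :: "'c \<Rightarrow> 'e"
  assumes inj: "inj_on f (carrier M)"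
begin

lemma transport_module_simps:
  "carrier (transport_module f M) = f ` carrier M"
  "\<zero>\<^bsub>transport_module f M\<^esub> = f \<zero>\<^bsub>M\<^esub>"
  "x \<in> carrier M \<Longrightarrow> y \<in> carrier M \<Longrightarrow>
    f x \<oplus>\<^bsub>transport_module f M\<^esub> f y = f (x \<oplus>\<^bsub>M\<^esub> y)"
  "x \<in> carrier M \<Longrightarrow> r \<odot>\<^bsub>transport_module f M\<^esub> f x = f (r \<odot>\<^bsub>M\<^esub> x)"
  using inj by (simp_all add: transport_module_def Let_def)

lemma transport_module_is_module: "module R (transport_module f M)"
proof (rule moduleI [OF R.cring_axioms])
  show "abelian_group (transport_module f M)"
  proof (rule abelian_groupI)
    show "\<exists>v \<in> carrier (transport_module f M).
        v \<oplus>\<^bsub>transport_module f M\<^esub> u = \<zero>\<^bsub>transport_module f M\<^esub>"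
      if u: "u \<in> carrier (transport_module f M)" for u
    proof -
      obtain x where x: "x \<in> carrier M" "u = f x"
        using u by (auto simp: transport_module_simps)
      then have "f (\<ominus>\<^bsub>M\<^esub> x) \<oplus>\<^bsub>transport_module f M\<^esub> u = \<zero>\<^bsub>transport_module f M\<^esub>"
        by (simp add: transport_module_simps M.l_neg)
      with x show ?thesis
        by (auto simp: transport_module_simps)
    qed
  qed (auto simp: transport_module_simps M.a_ac)
qed (auto simp: transport_module_simps smult_l_distr smult_r_distr smult_assoc1)

lemma annihilator_transport_module:
  assumes x: "x \<in> carrier M"
  shows "annihilator R (transport_module f M) (f x) = annihilator R M x"
  using x inj_on_eq_iff [OF inj smult_closed [OF _ x] M.zero_closed]
  by (auto simp: annihilator_def transport_module_simps)

end

lemma exists_quot_module_copy: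
  assumes N: "submodule N R M"
  shows "\<exists>Q :: ('a, 'c) module. module R Q \<and>
    annihilator R Q ` carrier Q =
    annihilator R (quot_module M N) ` carrier (quot_module M N)"
proof -
  interpret N: abelian_subgroup N M
    by (rule submodule_abelian_subgroup [OF N])
  interpret Q: module R "quot_module M N"
    by (rule quot_module_is_module [OF N])
  define rep where "rep X = (SOME x. x \<in> X)" for X :: "'c set"
  have coset: "N +>\<^bsub>M\<^esub> rep X = X" if X: "X \<in> carrier (quot_module M N)" for X
  proof -
    obtain x where x: "x \<in> carrier M" "X = N +>\<^bsub>M\<^esub> x"
      using X by (auto simp: carrier_quot_module)
    then have "rep X \<in> N +>\<^bsub>M\<^esub> x"
      unfolding rep_def using N.a_rcos_self someI by metis
    with x show ?thesis
      by (metis N.a_repr_independence')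
  qed
  have "inj_on rep (carrier (quot_module M N))"
    by (rule inj_onI) (metis coset)
  note copy = Q.transport_module_is_module [OF this]
    Q.annihilator_transport_module [OF this] Q.transport_module_simps(1) [OF this]
  have "annihilator R (transport_module rep (quot_module M N))
      ` carrier (transport_module rep (quot_module M N))
    = annihilator R (quot_module M N) ` carrier (quot_module M N)"
    by (auto simp: copy(2,3) image_image)
  with copy(1) show ?thesis
    by blast
qed


section \<open>Small and large torsion\<close>

context
  fixes \<aa> :: "'a set"
  assumes \<aa>: "ideal \<aa> R"
begin

lemma mem_ideal_carrier: "a \<in> \<aa> \<Longrightarrow> a \<in> carrier R"
  using \<aa> by (rule ideal.Icarr)

lemma small_torsion_submodule: "submodule (small_torsion R \<aa> M) R M"
proof (rule submoduleI)
  show "small_torsion R \<aa> M \<subseteq> carrier M"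
    by (auto simp: small_torsion_def)
  show "\<zero>\<^bsub>M\<^esub> \<in> small_torsion R \<aa> M"
    using ideal.Icarr [OF R.ideal_pow_is_ideal [OF \<aa>, of 0]]
    by (auto simp: small_torsion_def annihilator_def intro!: exI [of _ 0])
  show "\<ominus>\<^bsub>M\<^esub> x \<in> small_torsion R \<aa> M" if "x \<in> small_torsion R \<aa> M" for x
  proof -
    have "annihilator R M x \<subseteq> annihilator R M (\<ominus>\<^bsub>M\<^esub> x)"
      using that by (auto simp: small_torsion_def annihilator_def smult_r_minus)
    with that show ?thesis
      by (auto simp: small_torsion_def)
  qed
  show "r \<odot>\<^bsub>M\<^esub> x \<in> small_torsion R \<aa> M"
    if r: "r \<in> carrier R" and x: "x \<in> small_torsion R \<aa> M" for r x
  proof -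
    have "s \<odot>\<^bsub>M\<^esub> (r \<odot>\<^bsub>M\<^esub> x) = r \<odot>\<^bsub>M\<^esub> (s \<odot>\<^bsub>M\<^esub> x)" if "s \<in> carrier R" for s
      using that r x by (simp add: small_torsion_def smult_left_commute)
    then have "annihilator R M x \<subseteq> annihilator R M (r \<odot>\<^bsub>M\<^esub> x)"
      using r by (auto simp: annihilator_def)
    with r x show ?thesis
      by (auto simp: small_torsion_def)
  qed
  show "x \<oplus>\<^bsub>M\<^esub> y \<in> small_torsion R \<aa> M"
    if x: "x \<in> small_torsion R \<aa> M" and y: "y \<in> small_torsion R \<aa> M" for x y
  proof -
    obtain m n :: nat where mn: "\<aa> [^]\<^bsub>ideals_set R\<^esub> m \<subseteq> annihilator R M x"
        "\<aa> [^]\<^bsub>ideals_set R\<^esub> n \<subseteq> annihilator R M y"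
      using x y by (auto simp: small_torsion_def)
    have "annihilator R M x \<inter> annihilator R M y \<subseteq> annihilator R M (x \<oplus>\<^bsub>M\<^esub> y)"
      using x y by (auto simp: small_torsion_def annihilator_def smult_r_distr)
    moreover have "\<aa> [^]\<^bsub>ideals_set R\<^esub> max m n \<subseteq> annihilator R M x \<inter> annihilator R M y"
      using mn R.ideal_pow_antimono [OF \<aa>, of m "max m n"]
        R.ideal_pow_antimono [OF \<aa>, of n "max m n"] by auto
    ultimately show ?thesis
      using x y by (auto simp: small_torsion_def)
  qed
qed

lemma mem_large_torsion_iff:
  "x \<in> large_torsion R \<aa> M \<longleftrightarrow>
    x \<in> carrier M \<and> (\<forall>a \<in> \<aa>. \<exists>n::nat. (a [^] n) \<odot>\<^bsub>M\<^esub> x = \<zero>\<^bsub>M\<^esub>)"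
  using mem_ideal_carrier by (auto simp: large_torsion_def radical_def annihilator_def subset_iff)

lemma pow_smult_eq_zero_mono:
  assumes "(a [^] (m::nat)) \<odot>\<^bsub>M\<^esub> x = \<zero>\<^bsub>M\<^esub>" "m \<le> n" "a \<in> carrier R" "x \<in> carrier M"
  shows "(a [^] n) \<odot>\<^bsub>M\<^esub> x = \<zero>\<^bsub>M\<^esub>"
proof -
  have "a [^] n = a [^] (n - m) \<otimes> a [^] m"
    using assms(2-3) by (simp add: R.nat_pow_mult)
  then show ?thesis
    using assms by (simp add: smult_assoc1)
qed

lemma large_torsion_submodule: "submodule (large_torsion R \<aa> M) R M"
proof (rule submoduleI)
  show "large_torsion R \<aa> M \<subseteq> carrier M"
    by (auto simp: large_torsion_def)
  show "\<zero>\<^bsub>M\<^esub> \<in> large_torsion R \<aa> M"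
    using mem_ideal_carrier by (auto simp: mem_large_torsion_iff)
  show "\<ominus>\<^bsub>M\<^esub> x \<in> large_torsion R \<aa> M" if "x \<in> large_torsion R \<aa> M" for x
    using that mem_ideal_carrier by (fastforce simp: mem_large_torsion_iff smult_r_minus)
  show "r \<odot>\<^bsub>M\<^esub> x \<in> large_torsion R \<aa> M"
    if r: "r \<in> carrier R" and x: "x \<in> large_torsion R \<aa> M" for r x
  proof -
    have "s \<odot>\<^bsub>M\<^esub> (r \<odot>\<^bsub>M\<^esub> x) = r \<odot>\<^bsub>M\<^esub> (s \<odot>\<^bsub>M\<^esub> x)" if "s \<in> carrier R" for s
      using that r x by (simp add: large_torsion_def smult_left_commute)
    then have "s \<odot>\<^bsub>M\<^esub> (r \<odot>\<^bsub>M\<^esub> x) = \<zero>\<^bsub>M\<^esub>"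
      if "s \<in> carrier R" "s \<odot>\<^bsub>M\<^esub> x = \<zero>\<^bsub>M\<^esub>" for s
      using that r by simp
    with r x mem_ideal_carrier show ?thesis
      unfolding mem_large_torsion_iff by (meson R.nat_pow_closed smult_closed)
  qed
  show "x \<oplus>\<^bsub>M\<^esub> y \<in> large_torsion R \<aa> M"
    if x: "x \<in> large_torsion R \<aa> M" and y: "y \<in> large_torsion R \<aa> M" for x y
    unfolding mem_large_torsion_iff
  proof (intro conjI ballI)
    have xy: "x \<in> carrier M" "y \<in> carrier M"
      using x y by (auto simp: mem_large_torsion_iff)
    then show "x \<oplus>\<^bsub>M\<^esub> y \<in> carrier M"
      by simp
    fix a assume a: "a \<in> \<aa>"
    obtain m n :: nat where "(a [^] m) \<odot>\<^bsub>M\<^esub> x = \<zero>\<^bsub>M\<^esub>" "(a [^] n) \<odot>\<^bsub>M\<^esub> y = \<zero>\<^bsub>M\<^esub>"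
      using x y a unfolding mem_large_torsion_iff by metis
    then have "(a [^] max m n) \<odot>\<^bsub>M\<^esub> x = \<zero>\<^bsub>M\<^esub>" "(a [^] max m n) \<odot>\<^bsub>M\<^esub> y = \<zero>\<^bsub>M\<^esub>"
      using pow_smult_eq_zero_mono mem_ideal_carrier [OF a] xy max.cobounded1 max.cobounded2 by blast+
    then have "(a [^] max m n) \<odot>\<^bsub>M\<^esub> (x \<oplus>\<^bsub>M\<^esub> y) = \<zero>\<^bsub>M\<^esub>"
      using mem_ideal_carrier [OF a] xy by (simp add: smult_r_distr)
    then show "\<exists>n::nat. (a [^] n) \<odot>\<^bsub>M\<^esub> (x \<oplus>\<^bsub>M\<^esub> y) = \<zero>\<^bsub>M\<^esub>" ..
  qed
qed

lemma small_torsion_subset_large_torsion: "small_torsion R \<aa> M \<subseteq> large_torsion R \<aa> M"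
proof
  fix x assume "x \<in> small_torsion R \<aa> M"
  then obtain n :: nat where x: "x \<in> carrier M"
    and n: "\<aa> [^]\<^bsub>ideals_set R\<^esub> n \<subseteq> annihilator R M x"
    by (auto simp: small_torsion_def)
  have "(a [^] n) \<odot>\<^bsub>M\<^esub> x = \<zero>\<^bsub>M\<^esub>" if "a \<in> \<aa>" for a
    using R.pow_mem_ideal_pow [OF \<aa> that] n by (auto simp: annihilator_def)
  with x show "x \<in> large_torsion R \<aa> M"
    by (auto simp: mem_large_torsion_iff)
qed

text \<open>
  A prime containing the annihilator of \<open>x\<close> also contains the radical of the annihilator, and this
  contains \<open>\<aa>\<close> if \<open>x\<close> is a large torsion element.
\<close>

lemma weak_Ass_sub_torsion_subset_Var:
  assumes "N \<subseteq> large_torsion R \<aa> M"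
  shows "weak_Ass R (sub_module M N) \<subseteq> Var R \<aa>"
proof
  fix \<pp> assume "\<pp> \<in> weak_Ass R (sub_module M N)"
  then obtain x where spec: "\<pp> \<in> Spec R" and x: "x \<in> N"
    and ann: "annihilator R M x \<subseteq> \<pp>"
    by (auto simp: weak_Ass_def min_primes_def Var_def)
  interpret \<pp>: primeideal \<pp> R
    using spec by (simp add: Spec_def)
  have root: "a \<in> \<pp>" if "a [^] (n::nat) \<in> \<pp>" "a \<in> carrier R" for a n
    using that
  proof (induction n)
    case 0
    then show ?case
      using \<pp>.one_imp_carrier by auto
  next
    case (Suc n)
    then show ?case
      using \<pp>.I_prime [of "a [^] n" a] by auto
  qed
  have "\<aa> \<subseteq> radical R (annihilator R M x)"
    using x assms by (auto simp: large_torsion_def)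
  then have "\<aa> \<subseteq> \<pp>"
    using ann root unfolding radical_def by blast
  with spec show "\<pp> \<in> Var R \<aa>"
    by (simp add: Var_def)
qed

text \<open>
  If a power of \<open>a\<close> moves \<open>x\<close> into the large torsion, then a further power of the same \<open>a\<close> kills it.
  Large torsion asks for an exponent for each \<open>a\<close> separately, and so the two exponents just add up.
\<close>

lemma large_torsion_quot_large_torsion:
  "large_torsion R \<aa> (quot_module M (large_torsion R \<aa> M))
    = {\<zero>\<^bsub>quot_module M (large_torsion R \<aa> M)\<^esub>}" (is "large_torsion R \<aa> ?Q = _")
proof -
  let ?N = "large_torsion R \<aa> M"
  note N = large_torsion_submodule
  interpret Q: module R ?Q
    by (rule quot_module_is_module [OF N])
  have "X = \<zero>\<^bsub>?Q\<^esub>" if X: "X \<in> large_torsion R \<aa> ?Q" for X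
  proof -
    obtain x where x: "x \<in> carrier M" "X = ?N +>\<^bsub>M\<^esub> x"
      using X by (auto simp: large_torsion_def carrier_quot_module)
    have "\<exists>k::nat. (a [^] k) \<odot>\<^bsub>M\<^esub> x = \<zero>\<^bsub>M\<^esub>" if a: "a \<in> \<aa>" for a
    proof -
      obtain n :: nat where "(a [^] n) \<odot>\<^bsub>?Q\<^esub> X = \<zero>\<^bsub>?Q\<^esub>"
        using X a by (auto simp: Q.mem_large_torsion_iff [OF \<aa>])
      then have "(a [^] n) \<odot>\<^bsub>M\<^esub> x \<in> ?N"
        using x mem_ideal_carrier [OF a] by (simp add: quot_smult_coset [OF N] coset_eq_zero_iff [OF N])
      then obtain m :: nat where "(a [^] m) \<odot>\<^bsub>M\<^esub> ((a [^] n) \<odot>\<^bsub>M\<^esub> x) = \<zero>\<^bsub>M\<^esub>"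
        using a by (auto simp: mem_large_torsion_iff)
      then have "(a [^] (m + n)) \<odot>\<^bsub>M\<^esub> x = \<zero>\<^bsub>M\<^esub>"
        using x(1) mem_ideal_carrier [OF a] by (simp add: smult_assoc1 flip: R.nat_pow_mult)
      then show ?thesis ..
    qed
    then have "x \<in> ?N"
      using x(1) by (simp add: mem_large_torsion_iff)
    then show ?thesis
      using x coset_eq_zero_iff [OF N x(1)] by simp
  qed
  moreover have "\<zero>\<^bsub>?Q\<^esub> \<in> large_torsion R \<aa> ?Q"
    using mem_ideal_carrier by (auto simp: Q.mem_large_torsion_iff [OF \<aa>])
  ultimately show ?thesis
    by blast
qed

lemma small_torsion_quot_large_torsion:
  "small_torsion R \<aa> (quot_module M (large_torsion R \<aa> M))
    = {\<zero>\<^bsub>quot_module M (large_torsion R \<aa> M)\<^esub>}" (is "small_torsion R \<aa> ?Q = _")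
proof -
  interpret Q: module R ?Q
    by (rule quot_module_is_module [OF large_torsion_submodule])
  have "\<zero>\<^bsub>?Q\<^esub> \<in> small_torsion R \<aa> ?Q"
    using subgroup.one_closed [OF submodule.axioms(1) [OF Q.small_torsion_submodule [OF \<aa>]]]
    by simp
  then show ?thesis
    using Q.small_torsion_subset_large_torsion [OF \<aa>] large_torsion_quot_large_torsion by blast
qed

end

end


section \<open>Implications between the fairness properties\<close>

context
  fixes R :: "('a, 'r) ring_scheme" and \<aa> :: "'a set"
  assumes \<aa>: "ideal \<aa> R"
begin

lemma weakly_fair_imp_weakly_quasifair:
  assumes "weakly_fair TYPE('m) R \<aa>"
  shows "weakly_quasifair TYPE('m) R \<aa>"
  unfolding weakly_quasifair_def
proof (intro allI impI)
  fix M :: "('a, 'm) module" assume M: "module R M"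
  interpret module R M by (rule M)
  show "weak_Ass R (sub_module M (small_torsion R \<aa> M)) = weak_Ass R M \<inter> Var R \<aa>"
  proof (rule weak_Ass_sub_eq_inter_Var)
    show "weak_Ass R (quot_module M (small_torsion R \<aa> M)) \<inter> Var R \<aa> = {}"
      using assms M by (auto simp: weakly_fair_def)
  qed (rule small_torsion_submodule weak_Ass_sub_torsion_subset_Var
      small_torsion_subset_large_torsion \<aa>)+
qed

lemma weakly_large_fair_imp_weakly_large_quasifair:
  assumes "weakly_large_fair TYPE('m) R \<aa>"
  shows "weakly_large_quasifair TYPE('m) R \<aa>"
  unfolding weakly_large_quasifair_def
proof (intro allI impI)
  fix M :: "('a, 'm) module" assume M: "module R M"
  interpret module R M by (rule M)
  show "weak_Ass R (sub_module M (large_torsion R \<aa> M)) = weak_Ass R M \<inter> Var R \<aa>"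
  proof (rule weak_Ass_sub_eq_inter_Var)
    show "weak_Ass R (quot_module M (large_torsion R \<aa> M)) \<inter> Var R \<aa> = {}"
      using assms M by (auto simp: weakly_large_fair_def)
  qed (rule large_torsion_submodule weak_Ass_sub_torsion_subset_Var order_refl \<aa>)+
qed

lemma weakly_quasifair_imp_centred:
  assumes "weakly_quasifair TYPE('m) R \<aa>"
  shows "centred TYPE('m) R \<aa>"
  unfolding centred_def
proof (intro allI impI)
  fix M :: "('a, 'm) module" assume M: "module R M"
  interpret module R M by (rule M)
  interpret \<Gamma>: module R "sub_module M (small_torsion R \<aa> M)"
    by (rule sub_module_is_module [OF small_torsion_submodule [OF \<aa>]])
  show "small_torsion R \<aa> M = {\<zero>\<^bsub>M\<^esub>} \<longleftrightarrow> weak_Ass R M \<inter> Var R \<aa> = {}"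
    using \<Gamma>.weak_Ass_empty_iff assms M by (simp add: weakly_quasifair_def)
qed

lemma centred_imp_weakly_large_quasifair:
  assumes "centred TYPE('m) R \<aa>"
  shows "weakly_large_quasifair TYPE('m) R \<aa>"
  unfolding weakly_large_quasifair_def
proof (intro allI impI)
  fix M :: "('a, 'm) module" assume M: "module R M"
  interpret module R M by (rule M)
  let ?Q = "quot_module M (large_torsion R \<aa> M)"
  note N = large_torsion_submodule [OF \<aa>]
  interpret Q: module R ?Q
    by (rule quot_module_is_module [OF N])
  \<comment> \<open>Centredness can only be applied to a module over the type \<open>'m\<close>.\<close>
  obtain Q' :: "('a, 'm) module" where Q': "module R Q'"
    and ann: "annihilator R Q' ` carrier Q' = annihilator R ?Q ` carrier ?Q"
    using exists_quot_module_copy [OF N] by blast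
  interpret Q': module R Q' by (rule Q')
  show "weak_Ass R (sub_module M (large_torsion R \<aa> M)) = weak_Ass R M \<inter> Var R \<aa>"
  proof (rule weak_Ass_sub_eq_inter_Var [OF N])
    have "small_torsion R \<aa> Q' = {\<zero>\<^bsub>Q'\<^esub>}"
      using small_torsion_quot_large_torsion [OF \<aa>]
      unfolding Q.small_torsion_eq_zero_iff [OF \<aa>] Q'.small_torsion_eq_zero_iff [OF \<aa>] ann .
    then have "weak_Ass R Q' \<inter> Var R \<aa> = {}"
      using assms Q' by (simp add: centred_def)
    then show "weak_Ass R ?Q \<inter> Var R \<aa> = {}"
      unfolding weak_Ass_eq_Union_min_primes ann .
  qed (rule weak_Ass_sub_torsion_subset_Var [OF \<aa> order_refl])
qed

text \<open>
  All weakly associated primes of the large torsion submodule contain \<open>\<aa>\<close>, and so half-centredness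
  says that this submodule is its own small torsion.
\<close>

lemma half_centred_imp_small_eq_large_torsion:
  fixes M :: "('a, 'm) module"
  assumes half: "half_centred TYPE('m) R \<aa>" and M: "module R M"
  shows "small_torsion R \<aa> M = large_torsion R \<aa> M"
proof -
  interpret module R M by (rule M)
  let ?N = "sub_module M (large_torsion R \<aa> M)"
  have "module R ?N"
    by (rule sub_module_is_module [OF large_torsion_submodule [OF \<aa>]])
  moreover have "weak_Ass R ?N \<subseteq> Var R \<aa>"
    by (rule weak_Ass_sub_torsion_subset_Var [OF \<aa> order_refl])
  ultimately have "small_torsion R \<aa> ?N = carrier ?N"
    using half unfolding half_centred_def by blast
  then show ?thesis
    using small_torsion_subset_large_torsion [OF \<aa>]
    by (auto simp: small_torsion_def large_torsion_def)
qed

lemma half_centred_imp_weakly_fair_iff_large: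
  assumes "half_centred TYPE('m) R \<aa>"
  shows "weakly_fair TYPE('m) R \<aa> \<longleftrightarrow> weakly_large_fair TYPE('m) R \<aa>"
  using half_centred_imp_small_eq_large_torsion [OF assms]
  by (simp add: weakly_fair_def weakly_large_fair_def)

lemma half_centred_imp_weakly_quasifair_iff_large:
  assumes "half_centred TYPE('m) R \<aa>"
  shows "weakly_quasifair TYPE('m) R \<aa> \<longleftrightarrow> weakly_large_quasifair TYPE('m) R \<aa>"
  using half_centred_imp_small_eq_large_torsion [OF assms]
  by (simp add: weakly_quasifair_def weakly_large_quasifair_def)

end

theorem mainTheorem3:
  fixes R :: "('a, 'r) ring_scheme" and \<aa> :: "'a set"
  assumes "cring R" and "ideal \<aa> R"
  shows
    "((weakly_fair TYPE('m) R \<aa> \<longrightarrow> weakly_quasifair TYPE('m) R \<aa>) \<and>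
      (weakly_quasifair TYPE('m) R \<aa> \<longrightarrow> centred TYPE('m) R \<aa>) \<and>
      (centred TYPE('m) R \<aa> \<longrightarrow> weakly_large_quasifair TYPE('m) R \<aa>) \<and>
      (weakly_large_fair TYPE('m) R \<aa> \<longrightarrow> weakly_large_quasifair TYPE('m) R \<aa>)) \<and>
     (half_centred TYPE('m) R \<aa> \<longrightarrow>
      (weakly_fair TYPE('m) R \<aa> \<longleftrightarrow> weakly_large_fair TYPE('m) R \<aa>) \<and>
      (weakly_quasifair TYPE('m) R \<aa> \<longleftrightarrow> centred TYPE('m) R \<aa>) \<and>
      (centred TYPE('m) R \<aa> \<longleftrightarrow> weakly_large_quasifair TYPE('m) R \<aa>) \<and>
      (weakly_fair TYPE('m) R \<aa> \<longrightarrow> weakly_quasifair TYPE('m) R \<aa>) \<and>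
      (weakly_large_fair TYPE('m) R \<aa> \<longrightarrow> weakly_large_quasifair TYPE('m) R \<aa>))"
  using weakly_fair_imp_weakly_quasifair [OF assms(2)]
    weakly_quasifair_imp_centred [OF assms(2)]
    centred_imp_weakly_large_quasifair [OF assms(2)]
    weakly_large_fair_imp_weakly_large_quasifair [OF assms(2)]
    half_centred_imp_weakly_fair_iff_large [OF assms(2)]
    half_centred_imp_weakly_quasifair_iff_large [OF assms(2)]
  by blast

end
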